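(* Let $\mathbb{A}$ be a unital $C^*$-algebra, let $(X,\mathbb{A},p)$ be a complete $C^*$-algebra valued partial metric space, and let $T:X\to X$ be a mapping for which there is a real number $k\in(0,\tfrac12)$ such that $$p(Tx,Ty)\preceq k\,[p(x,Tx)+p(y,Ty)]\quad\text{for all }x,y\in X.$$ Then $T$ has a unique fixed point $u\in X$, and $p(u,u)=\theta$.
   Context: $\mathbb{A}$ is a unital $C^*$-algebra with unit $I$ and zero element $\theta$; $\mathbb{A}_+$ is the set of positive elements, and for self-adjoint $a,b$, $a\preceq b$ means $b-a\in\mathbb{A}_+$. A $C^*$-algebra valued partial metric space $(X,\mathbb{A},p)$ is a non-empty set $X$ with $p:X\times X\to\mathbb{A}$ such that for all $x,y,z\in X$: (i) $\theta\preceq p(x,y)$, and $p(x,x)=p(y,y)=p(x,y)$ iff $x=y$; (ii) $p(x,y)=p(y,x)$; (iii) $p(x,x)\preceq p(x,y)$; (iv) $p(x,y)\preceq p(x,z)+p(z,y)-p(z,z)$. A sequence $(x_n)$ converges to $x$ if $\lim_n (p(x_n,x)-p(x,x))=\theta$ in norm. It is partial Cauchy if for every $\varepsilon>0$ there is $N$ such that for all $n,m>N$, $q_{n,m}q_{n,m}^*\preceq\varepsilon^2 I$, where $q_{n,m}=p(x_n,x_m)-\frac12p(x_n,x_n)-\frac12p(x_m,x_m)$. The space is complete if every partial Cauchy sequence $(x_n)$ converges to a point $x\in X$ such that $\lim_n\bigl(p(x_n,x)-\frac12p(x_n,x_n)-\frac12p(x,x)\bigr)=\theta$. *)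

theory Defs
  imports "HOL-Analysis.Analysis"
begin

text \<open>
  Unital \<open>C\<^sup>*\<close>-algebras as a type class.  The unit comes from \<^class>\<open>monoid_mult\<close> rather than
  from \<^class>\<open>real_normed_algebra_1\<close>, so that the zero algebra is not excluded; in every other
  case \<open>norm 1 = 1\<close> follows from the axioms.  The scalars are complex, and \<open>scaleC_of_real\<close> makes
  the complex scalar multiplication extend the real one.
\<close>

class unital_cstar_algebra = banach + real_normed_algebra + monoid_mult +
  fixes scaleC :: "complex \<Rightarrow> 'a \<Rightarrow> 'a"  (infixr \<open>*\<^sub>C\<close> 75)
    and adj :: "'a \<Rightarrow> 'a"
  assumes scaleC_add_right: "c *\<^sub>C (x + y) = c *\<^sub>C x + c *\<^sub>C y"
    and scaleC_add_left: "(c + d) *\<^sub>C x = c *\<^sub>C x + d *\<^sub>C x"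
    and scaleC_scaleC: "c *\<^sub>C (d *\<^sub>C x) = (c * d) *\<^sub>C x"
    and scaleC_of_real: "complex_of_real r *\<^sub>C x = r *\<^sub>R x"
    and mult_scaleC_left: "(c *\<^sub>C x) * y = c *\<^sub>C (x * y)"
    and mult_scaleC_right: "x * (c *\<^sub>C y) = c *\<^sub>C (x * y)"
    and norm_scaleC: "norm (c *\<^sub>C x) = cmod c * norm x"
    and adj_adj: "adj (adj x) = x"
    and adj_add: "adj (x + y) = adj x + adj y"
    and adj_scaleC: "adj (c *\<^sub>C x) = cnj c *\<^sub>C adj x"
    and adj_mult: "adj (x * y) = adj y * adj x"
    and cstar_identity: "norm (adj x * x) = (norm x)\<^sup>2"

definition cstar_spectrum :: "'a::unital_cstar_algebra \<Rightarrow> complex set" where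
  "cstar_spectrum a = {z. \<not> (\<exists>b. (a - z *\<^sub>C 1) * b = 1 \<and> b * (a - z *\<^sub>C 1) = 1)}"

definition self_adjoint :: "'a::unital_cstar_algebra \<Rightarrow> bool" where
  "self_adjoint a \<longleftrightarrow> adj a = a"

definition cstar_pos :: "'a::unital_cstar_algebra set" where
  "cstar_pos = {a. self_adjoint a \<and> cstar_spectrum a \<subseteq> complex_of_real ` {0..}}"

definition cstar_le :: "'a::unital_cstar_algebra \<Rightarrow> 'a \<Rightarrow> bool"  (infix \<open>\<preceq>\<close> 50) where
  "a \<preceq> b \<longleftrightarrow> self_adjoint a \<and> self_adjoint b \<and> b - a \<in> cstar_pos"

locale cstar_partial_metric_space =
  fixes X :: "'b set" and p :: "'b \<Rightarrow> 'b \<Rightarrow> 'a::unital_cstar_algebra"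
  assumes nonempty: "X \<noteq> {}"
    and nonneg: "\<lbrakk>x \<in> X; y \<in> X\<rbrakk> \<Longrightarrow> 0 \<preceq> p x y"
    and eq_iff: "\<lbrakk>x \<in> X; y \<in> X\<rbrakk> \<Longrightarrow> (p x x = p y y \<and> p y y = p x y) \<longleftrightarrow> x = y"
    and sym: "\<lbrakk>x \<in> X; y \<in> X\<rbrakk> \<Longrightarrow> p x y = p y x"
    and small_self_distance: "\<lbrakk>x \<in> X; y \<in> X\<rbrakk> \<Longrightarrow> p x x \<preceq> p x y"
    and triangle: "\<lbrakk>x \<in> X; y \<in> X; z \<in> X\<rbrakk> \<Longrightarrow> p x y \<preceq> p x z + p z y - p z z"
begin

definition pm_converges :: "(nat \<Rightarrow> 'b) \<Rightarrow> 'b \<Rightarrow> bool" where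
  "pm_converges s x \<longleftrightarrow> (\<lambda>n. p (s n) x - p x x) \<longlonglongrightarrow> 0"

definition centred :: "'b \<Rightarrow> 'b \<Rightarrow> 'a" where
  "centred x y = p x y - (1/2) *\<^sub>R p x x - (1/2) *\<^sub>R p y y"

definition partial_Cauchy :: "(nat \<Rightarrow> 'b) \<Rightarrow> bool" where
  "partial_Cauchy s \<longleftrightarrow>
    (\<forall>\<epsilon>>0. \<exists>N. \<forall>n>N. \<forall>m>N.
      centred (s n) (s m) * adj (centred (s n) (s m)) \<preceq> \<epsilon>\<^sup>2 *\<^sub>R 1)"

definition pm_complete :: bool where
  "pm_complete \<longleftrightarrow>
    (\<forall>s. (\<forall>n. s n \<in> X) \<and> partial_Cauchy s \<longrightarrow>
      (\<exists>x\<in>X. pm_converges s x \<and> (\<lambda>n. centred (s n) x) \<longlonglongrightarrow> 0))"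

end

end

theory Submission
  imports Defs
begin

text \<open>
  As in Kannan's theorem for metric spaces, the iterates \<open>x\<^sub>n\<close> of any starting point satisfy
  \<open>(1 - k) p(x\<^sub>n\<^sub>+\<^sub>1, x\<^sub>n\<^sub>+\<^sub>2) \<preceq> k p(x\<^sub>n, x\<^sub>n\<^sub>+\<^sub>1)\<close>.  Consecutive distances therefore decay
  geometrically in norm, with ratio \<open>k / (1 - k) < 1\<close>, and by the contraction condition all
  distances \<open>p(x\<^sub>n, x\<^sub>m)\<close> tend to \<open>0\<close> as \<open>n\<close> and \<open>m\<close> grow.  The sequence is partial Cauchy, and its limit \<open>u\<close> has
  \<open>p(u, u) = 0\<close> because \<open>p(x\<^sub>n, u)\<close> converges both to \<open>p(u, u)\<close> and to \<open>p(u, u) / 2\<close>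
  (\<open>limit_of_small_sequence\<close>).  The triangle inequality through \<open>x\<^sub>n\<^sub>+\<^sub>1\<close> gives \<open>p(u, T u) = 0\<close>, so
  \<open>u\<close> is fixed.  Any fixed point \<open>v\<close> has \<open>p(v, v) \<preceq> 2k p(v, v)\<close>, hence \<open>p(v, v) = 0\<close>, hence
  \<open>p(v, u) = 0\<close>.

  Passing from the order to the norm rests on two properties of the positive cone, which is
  defined by the spectrum: sums of positive elements are positive (\<open>cstar_pos_add\<close>), and the norm is
  monotone on positive elements (\<open>norm_mono_cstar_pos\<close>).  Both follow from the fact that a
  self-adjoint \<open>a\<close> of norm at most \<open>t\<close> is positive exactly if \<open>\<parallel>t 1 - a\<parallel> \<le> t\<close>, which in turn needs
  that self-adjoint elements have real spectrum (\<open>spectrum_self_adjoint_real\<close>) and that their norm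
  is bounded by their spectral radius (\<open>norm_le_spectral_bound\<close>).  The last point is usually derived
  from Liouville's theorem for vector-valued functions; the proof here is a variant of Rickart's
  elementary argument, which averages the resolvent over roots of unity and uses only its
  uniform continuity.
\<close>

section \<open>Scalars, involution and norm\<close>

lemma scaleC_one [simp]: "1 *\<^sub>C (x::'a::unital_cstar_algebra) = x"
  using scaleC_of_real[of 1 x] by simp

lemma scaleC_zero_left [simp]: "0 *\<^sub>C (x::'a::unital_cstar_algebra) = 0"
  using scaleC_of_real[of 0 x] by simp

lemma scaleC_minus_left: "(- c) *\<^sub>C (x::'a::unital_cstar_algebra) = - (c *\<^sub>C x)"
  using scaleC_add_left[of "- c" c x] by (simp add: eq_neg_iff_add_eq_0)

lemma scaleC_diff_left: "(c - d) *\<^sub>C (x::'a::unital_cstar_algebra) = c *\<^sub>C x - d *\<^sub>C x"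
  using scaleC_add_left[of c "- d" x] by (simp add: scaleC_minus_left)

lemma scaleC_zero_right [simp]: "c *\<^sub>C (0::'a::unital_cstar_algebra) = 0"
  using scaleC_add_right[of c 0 "0::'a"] by simp

lemma scaleC_minus_right: "c *\<^sub>C (- x::'a::unital_cstar_algebra) = - (c *\<^sub>C x)"
  using scaleC_add_right[of c "- x" x] by (simp add: eq_neg_iff_add_eq_0)

lemma scaleC_diff_right: "c *\<^sub>C (x - y::'a::unital_cstar_algebra) = c *\<^sub>C x - c *\<^sub>C y"
  using scaleC_add_right[of c x "- y"] by (simp add: scaleC_minus_right)

lemma adj_scaleR: "adj (r *\<^sub>R x) = r *\<^sub>R adj (x::'a::unital_cstar_algebra)"
  using adj_scaleC[of "complex_of_real r" x] by (simp add: scaleC_of_real)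

lemma adj_zero [simp]: "adj (0::'a::unital_cstar_algebra) = 0"
  using adj_add[of 0 "0::'a"] by simp

lemma adj_minus: "adj (- x) = - adj (x::'a::unital_cstar_algebra)"
  using adj_scaleR[of "-1" x] by simp

lemma adj_diff: "adj (x - y) = adj x - adj (y::'a::unital_cstar_algebra)"
  using adj_add[of x "- y"] by (simp add: adj_minus)

lemma adj_one [simp]: "adj (1::'a::unital_cstar_algebra) = 1"
  using adj_mult[of "adj 1" "1::'a"] by (simp add: adj_adj)

lemma norm_unit_le_1: "norm (1::'a::unital_cstar_algebra) \<le> 1"
  using cstar_identity[of "1::'a"] by (cases "norm (1::'a) = 0") (auto simp: power2_eq_square)

lemma norm_adj: "norm (adj x) = norm (x::'a::unital_cstar_algebra)"
proof -
  have le: "norm y \<le> norm (adj y)" for y :: 'a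
  proof (cases "y = 0")
    case False
    have "norm y * norm y \<le> norm (adj y) * norm y"
      using cstar_identity[of y] norm_mult_ineq[of "adj y" y] by (simp add: power2_eq_square)
    then show ?thesis using False by simp
  qed simp
  show ?thesis using le[of x] le[of "adj x"] by (simp add: adj_adj)
qed

lemma norm_square_self_adjoint:
  "self_adjoint (a::'a::unital_cstar_algebra) \<Longrightarrow> norm (a * a) = (norm a)\<^sup>2"
  using cstar_identity[of a] by (simp add: self_adjoint_def)

section \<open>Inverses and the spectrum\<close>

definition is_inverse :: "'a::unital_cstar_algebra \<Rightarrow> 'a \<Rightarrow> bool" where
  "is_inverse x y \<longleftrightarrow> x * y = 1 \<and> y * x = 1"

lemma in_spectrum_iff: "z \<in> cstar_spectrum a \<longleftrightarrow> (\<nexists>b. is_inverse (a - z *\<^sub>C 1) b)"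
  by (simp add: cstar_spectrum_def is_inverse_def)

lemma is_inverse_scaleC:
  assumes "is_inverse x y" "c \<noteq> 0"
  shows "is_inverse (c *\<^sub>C x) (inverse c *\<^sub>C y)"
  using assms by (simp add: is_inverse_def mult_scaleC_left mult_scaleC_right scaleC_scaleC)

text \<open>Instead of summing the Neumann series, the two one-sided inverses are the fixed points of
  the contractions \<open>y \<mapsto> 1 + x y\<close> and \<open>y \<mapsto> 1 + y x\<close>.\<close>

lemma inverse_one_minus_exists:
  fixes x :: "'a::unital_cstar_algebra"
  assumes "norm x < 1"
  shows "\<exists>y. is_inverse (1 - x) y"
proof -
  have "\<exists>!y. 1 + x * y = y"
  proof (rule banach_fix_type[OF norm_ge_zero assms], intro allI)
    show "dist (1 + x * y) (1 + x * z) \<le> norm x * dist y z" for y z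
      using norm_mult_ineq[of x "y - z"] by (simp add: dist_norm right_diff_distrib)
  qed
  then obtain y where y: "1 + x * y = y" by blast
  have "\<exists>!y. 1 + y * x = y"
  proof (rule banach_fix_type[OF norm_ge_zero assms], intro allI)
    show "dist (1 + y * x) (1 + z * x) \<le> norm x * dist y z" for y z
      using norm_mult_ineq[of "y - z" x] by (simp add: dist_norm left_diff_distrib mult.commute)
  qed
  then obtain z where z: "1 + z * x = z" by blast
  have r: "(1 - x) * y = 1" using y by (simp add: algebra_simps)
  have l: "z * (1 - x) = 1" using z by (simp add: algebra_simps)
  have "z = z * ((1 - x) * y)" using r by simp
  also have "\<dots> = y" using l by (simp add: mult.assoc[symmetric])
  finally show ?thesis using r l by (auto simp: is_inverse_def)
qed

lemma spectrum_norm_bound: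
  assumes "z \<in> cstar_spectrum (a::'a::unital_cstar_algebra)"
  shows "cmod z \<le> norm a"
proof (rule ccontr)
  assume "\<not> ?thesis"
  then have z: "norm a < cmod z" by simp
  then have z0: "z \<noteq> 0" using norm_ge_zero[of a] by auto
  have "norm a / cmod z < 1" using z z0 by simp
  then have "norm (inverse z *\<^sub>C a) < 1"
    by (simp add: norm_scaleC norm_inverse divide_inverse mult.commute)
  then obtain y where "is_inverse (1 - inverse z *\<^sub>C a) y" using inverse_one_minus_exists by blast
  from is_inverse_scaleC[OF this, of "- z"] z0
  have "is_inverse (a - z *\<^sub>C 1) (inverse (- z) *\<^sub>C y)"
    by (simp add: scaleC_diff_right scaleC_scaleC scaleC_minus_left)
  with assms show False by (auto simp: in_spectrum_iff)
qed

lemma spectrum_shift: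
  assumes "z \<in> cstar_spectrum (a::'a::unital_cstar_algebra)"
  shows "z + w \<in> cstar_spectrum (a + w *\<^sub>C 1)"
  using assms by (simp add: in_spectrum_iff scaleC_add_left)

lemma spectrum_reflect:
  assumes "z \<in> cstar_spectrum (w *\<^sub>C 1 - a::'a::unital_cstar_algebra)"
  shows "w - z \<in> cstar_spectrum a"
proof (rule ccontr)
  assume "w - z \<notin> cstar_spectrum a"
  then obtain y where "is_inverse (a - (w - z) *\<^sub>C 1) y" by (auto simp: in_spectrum_iff)
  from is_inverse_scaleC[OF this, of "-1"]
  have "is_inverse (w *\<^sub>C 1 - a - z *\<^sub>C 1) (- y)"
    by (simp add: scaleC_minus_left scaleC_diff_left algebra_simps)
  with assms show False by (auto simp: in_spectrum_iff)
qed

text \<open>A spectral value \<open>\<alpha> + i\<beta>\<close> of \<open>a\<close> moves to \<open>\<alpha> + i(\<beta> + s)\<close> when \<open>is\<close> is added to \<open>a\<close>, whereas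
  the \<open>C\<^sup>*\<close>-identity bounds the square of the norm of \<open>a + is\<close> by \<open>\<parallel>a\<parallel>\<^sup>2 + s\<^sup>2\<close>.  The
  cross term \<open>2\<beta>s\<close> is unbounded in \<open>s\<close> unless \<open>\<beta> = 0\<close>.\<close>

lemma spectrum_self_adjoint_real:
  fixes a :: "'a::unital_cstar_algebra"
  assumes sa: "self_adjoint a" and z: "z \<in> cstar_spectrum a"
  shows "z = complex_of_real (Re z)"
proof -
  have bound: "(Re z)\<^sup>2 + (Im z + s)\<^sup>2 \<le> (norm a)\<^sup>2 + s\<^sup>2" for s
  proof -
    define c where "c = a + (\<i> * of_real s) *\<^sub>C 1"
    have adj_c: "adj c = a - (\<i> * of_real s) *\<^sub>C 1"
      using sa by (simp add: c_def adj_add adj_scaleC self_adjoint_def scaleC_minus_left)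
    have "((\<i> * of_real s) *\<^sub>C 1) * ((\<i> * of_real s) *\<^sub>C (1::'a)) = - ((s\<^sup>2) *\<^sub>R 1)"
    proof -
      have "(\<i> * of_real s) * (\<i> * of_real s) = - complex_of_real (s\<^sup>2)"
        by (simp add: power2_eq_square complex_eq_iff)
      then show ?thesis
        by (simp add: mult_scaleC_left mult_scaleC_right scaleC_scaleC scaleC_minus_left
            scaleC_of_real del: of_real_power)
    qed
    then have "adj c * c = a * a + s\<^sup>2 *\<^sub>R 1"
      unfolding adj_c unfolding c_def
      by (simp add: algebra_simps mult_scaleC_left mult_scaleC_right scaleC_diff_right)
    then have "(norm c)\<^sup>2 \<le> norm (a * a) + norm (s\<^sup>2 *\<^sub>R (1::'a))"
      using cstar_identity[of c] norm_triangle_ineq[of "a * a" "s\<^sup>2 *\<^sub>R (1::'a)"] by simp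
    also have "\<dots> \<le> (norm a)\<^sup>2 + s\<^sup>2"
      using norm_square_self_adjoint[OF sa] norm_unit_le_1[where 'a='a]
      by (simp add: mult_left_le)
    finally have c: "(norm c)\<^sup>2 \<le> (norm a)\<^sup>2 + s\<^sup>2" .
    have "cmod (z + \<i> * of_real s) \<le> norm c"
      unfolding c_def by (intro spectrum_norm_bound spectrum_shift z)
    then have "(cmod (z + \<i> * of_real s))\<^sup>2 \<le> (norm c)\<^sup>2" by (simp add: power_mono)
    with c show ?thesis by (simp add: cmod_power2)
  qed
  have "Im z = 0"
  proof (rule ccontr)
    assume im: "Im z \<noteq> 0"
    have "2 * Im z * s \<le> (norm a)\<^sup>2" for s
      using bound[of s] zero_le_power2[of "Re z"] zero_le_power2[of "Im z"]
      unfolding power2_sum by linarith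
    from this[of "((norm a)\<^sup>2 + 1) / (2 * Im z)"] im show False by simp
  qed
  then show ?thesis by (simp add: complex_eq_iff)
qed

section \<open>The norm of a self-adjoint element\<close>

text \<open>The partial fraction identity \<open>1/(1 - y) + 1/(1 + y) = 2/(1 - y\<^sup>2)\<close>.\<close>

lemma is_inverse_one_minus_square:
  fixes y :: "'a::unital_cstar_algebra"
  assumes "is_inverse (1 - y) c" "is_inverse (1 + y) d"
  shows "is_inverse (1 - y * y) ((1/2) *\<^sub>R (c + d))"
proof -
  have e1: "1 - y * y = (1 + y) * (1 - y)" and e2: "1 - y * y = (1 - y) * (1 + y)"
    by (simp_all add: algebra_simps)
  have "(1 - y * y) * c = 1 + y" "(1 - y * y) * d = 1 - y"
    using assms unfolding is_inverse_def by (metis e1 mult.assoc mult_1_right)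
      (metis assms(2) e2 is_inverse_def mult.assoc mult_1_right)
  moreover have "c * (1 - y * y) = 1 + y" "d * (1 - y * y) = 1 - y"
    using assms unfolding is_inverse_def by (metis e2 mult.assoc mult_1_left)
      (metis assms(2) e1 is_inverse_def mult.assoc mult_1_left)
  moreover have "(1/2) *\<^sub>R (1 + 1) = (1::'a)"
    by (metis scaleR_half_double)
  ultimately show ?thesis
    by (simp add: is_inverse_def distrib_left distrib_right)
qed

text \<open>The radial variation of the resolvent function \<open>z \<mapsto> (1 - z b)\<^sup>-\<^sup>1\<close> between the unit circle
  and the circle of radius \<open>s\<close> is at most \<open>e\<close>.  That the inverses exist on both circles is part of
  the condition, so that it passes from \<open>b\<close> to \<open>b\<^sup>2\<close> as a whole.\<close>

definition resolvent_variation_le :: "'a::unital_cstar_algebra \<Rightarrow> real \<Rightarrow> real \<Rightarrow> bool" where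
  "resolvent_variation_le b s e \<longleftrightarrow>
    (\<forall>w. cmod w = 1 \<longrightarrow> (\<exists>c d. is_inverse (1 - w *\<^sub>C b) c \<and>
       is_inverse (1 - (of_real s * w) *\<^sub>C b) d \<and> norm (c - d) \<le> e))"

text \<open>By the partial fraction identity, the resolvent function of \<open>b\<^sup>2\<close> at \<open>v\<^sup>2\<close> is the mean of the
  values at \<open>v\<close> and \<open>-v\<close> of that of \<open>b\<close>.  A mean does not increase the variation, while the
  radius \<open>s\<close> is squared.\<close>

lemma resolvent_variation_square:
  assumes "resolvent_variation_le b s e"
  shows "resolvent_variation_le (b * b) (s\<^sup>2) e"
  unfolding resolvent_variation_le_def
proof (intro allI impI)
  fix w :: complex
  assume w: "cmod w = 1"
  define v where "v = csqrt w"
  have vw: "v * v = w" by (metis v_def power2_csqrt power2_eq_square)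
  have v: "cmod v = 1" using w by (simp add: v_def)
  obtain c d where c: "is_inverse (1 - v *\<^sub>C b) c" and d: "is_inverse (1 - (of_real s * v) *\<^sub>C b) d"
    and cd: "norm (c - d) \<le> e"
    using assms v unfolding resolvent_variation_le_def by blast
  obtain c' d' where c': "is_inverse (1 + v *\<^sub>C b) c'"
    and d': "is_inverse (1 + (of_real s * v) *\<^sub>C b) d'" and cd': "norm (c' - d') \<le> e"
    using assms[unfolded resolvent_variation_le_def, rule_format, of "- v"] v
    by (auto simp: scaleC_minus_left)
  have eq1: "(v *\<^sub>C b) * (v *\<^sub>C b) = w *\<^sub>C (b * b)"
    by (simp add: mult_scaleC_left mult_scaleC_right scaleC_scaleC vw)
  have "(of_real s * v) * (of_real s * v) = of_real (s\<^sup>2) * w"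
    using vw by (simp add: power2_eq_square algebra_simps)
  then have eq2: "((of_real s * v) *\<^sub>C b) * ((of_real s * v) *\<^sub>C b) = (of_real (s\<^sup>2) * w) *\<^sub>C (b * b)"
    by (simp add: mult_scaleC_left mult_scaleC_right scaleC_scaleC)
  have "norm ((1/2) *\<^sub>R (c + c') - (1/2) *\<^sub>R (d + d')) = norm ((1/2) *\<^sub>R ((c - d) + (c' - d')))"
    by (simp add: algebra_simps)
  also have "\<dots> \<le> e"
    using cd cd' norm_triangle_ineq[of "c - d" "c' - d'"] by simp
  finally show "\<exists>c d. is_inverse (1 - w *\<^sub>C (b * b)) c \<and>
      is_inverse (1 - (of_real (s\<^sup>2) * w) *\<^sub>C (b * b)) d \<and> norm (c - d) \<le> e"
    using is_inverse_one_minus_square[OF c c'] is_inverse_one_minus_square[OF d d']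
    unfolding eq1 eq2 by blast
qed

lemma resolvent_variation_power:
  assumes "resolvent_variation_le b s e"
  shows "resolvent_variation_le (b ^ 2 ^ m) (s ^ 2 ^ m) e"
proof (induction m)
  case (Suc m)
  from resolvent_variation_square[OF this] show ?case
    by (simp add: power2_eq_square power_add[symmetric] mult_2)
qed (use assms in simp)

lemma resolvent_continuous:
  fixes b :: "'a::unital_cstar_algebra"
  assumes R: "\<And>z. z \<in> S \<Longrightarrow> is_inverse (1 - z *\<^sub>C b) (R z)"
  shows "continuous_on S R"
  unfolding continuous_on_def
proof
  fix w
  assume w: "w \<in> S"
  define K where "K = 2 * norm (R w) * norm (R w) * norm b"
  \<comment> \<open>The resolvent identity, which for \<open>z\<close> close to \<open>w\<close> also bounds \<open>R z\<close> by twice \<open>R w\<close>.\<close>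
  have diff: "norm (R z - R w) \<le> norm (R z) * (cmod (z - w) * norm b * norm (R w))" if "z \<in> S" for z
  proof -
    have "R z - R w = R z * ((1 - w *\<^sub>C b) * R w) - (R z * (1 - z *\<^sub>C b)) * R w"
      using R[OF w] R[OF that] by (simp add: is_inverse_def)
    also have "\<dots> = R z * (((z - w) *\<^sub>C b) * R w)"
      by (simp add: scaleC_diff_left algebra_simps)
    also have "norm \<dots> \<le> norm (R z) * (norm ((z - w) *\<^sub>C b) * norm (R w))"
      by (rule order_trans[OF norm_mult_ineq mult_left_mono[OF norm_mult_ineq norm_ge_zero]])
    finally show ?thesis by (simp add: norm_scaleC)
  qed
  have lim: "((\<lambda>z. cmod (z - w) * norm b * norm (R w)) \<longlongrightarrow> 0) (at w within S)"
    by (auto intro!: tendsto_eq_intros)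
  have ev: "\<forall>\<^sub>F z in at w within S. cmod (z - w) * norm b * norm (R w) < 1/2"
    by (rule order_tendstoD(2)[OF lim]) simp
  have eventually_in_S: "\<forall>\<^sub>F z in at w within S. z \<in> S"
    by (simp add: eventually_at_filter)
  have "\<forall>\<^sub>F z in at w within S. norm (R z - R w) \<le> K * cmod (z - w)"
    using ev eventually_in_S
  proof eventually_elim
    case (elim z)
    let ?q = "cmod (z - w) * norm b * norm (R w)"
    have "norm (R z) * ?q \<le> norm (R z) * (1/2)"
      using elim(1) by (intro mult_left_mono) auto
    with diff[of z] elim have "norm (R z - R w) \<le> norm (R z) / 2" by simp
    then have "norm (R z) \<le> 2 * norm (R w)"
      using norm_triangle_sub[of "R z" "R w"] by simp
    then have "norm (R z) * ?q \<le> (2 * norm (R w)) * ?q"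
      by (intro mult_right_mono) auto
    with diff[of z] elim show ?case by (simp add: K_def algebra_simps)
  qed
  moreover have "((\<lambda>z. K * cmod (z - w)) \<longlongrightarrow> 0) (at w within S)"
    by (auto intro!: tendsto_eq_intros)
  ultimately have "((\<lambda>z. R z - R w) \<longlongrightarrow> 0) (at w within S)"
    by (rule Lim_null_comparison)
  then show "(R \<longlongrightarrow> R w) (at w within S)" by (simp add: LIM_zero_iff)
qed

lemma norm_power_two_power_self_adjoint:
  fixes b :: "'a::unital_cstar_algebra"
  assumes "self_adjoint b" "norm b = 1"
  shows "self_adjoint (b ^ 2 ^ m) \<and> norm (b ^ 2 ^ m) = 1"
proof (induction m)
  case (Suc m)
  have "b ^ 2 ^ Suc m = b ^ 2 ^ m * b ^ 2 ^ m" by (simp add: power_add[symmetric] mult_2)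
  with Suc norm_square_self_adjoint[of "b ^ 2 ^ m"] show ?case
    by (simp add: self_adjoint_def adj_mult)
qed (use assms in simp)

text \<open>If all \<open>1 - z b\<close> with \<open>|z| \<le> 1\<close> were invertible, then uniform continuity on the disc would give
  an \<open>s < 1\<close> with small radial variation, and the same variation would hold for \<open>B = b\<^sup>N\<close> and
  \<open>s\<^sup>N\<close> with \<open>N\<close> any power of two.  As \<open>s\<^sup>N\<close> tends to \<open>0\<close>, the inverse of \<open>1 - s\<^sup>N B\<close> tends to \<open>1\<close>, so
  that of \<open>1 - B\<close> is close to \<open>1\<close>; this contradicts \<open>\<parallel>B\<parallel> = 1\<close>.\<close>

lemma not_all_invertible_on_disc:
  fixes b :: "'a::unital_cstar_algebra"
  assumes sa: "self_adjoint b" and b1: "norm b = 1"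
  shows "\<exists>z. cmod z \<le> 1 \<and> (\<nexists>c. is_inverse (1 - z *\<^sub>C b) c)"
proof (rule ccontr)
  assume "\<not> ?thesis"
  then have "\<forall>z\<in>cball 0 1. \<exists>c. is_inverse (1 - z *\<^sub>C b) c" by auto
  then obtain R where R: "\<And>z. z \<in> cball 0 1 \<Longrightarrow> is_inverse (1 - z *\<^sub>C b) (R z)" by metis
  have "uniformly_continuous_on (cball 0 1) R"
    using resolvent_continuous[of "cball 0 1" b R] R by (intro compact_uniformly_continuous) auto
  then obtain \<delta> where \<delta>: "\<delta> > 0"
    and unif: "\<And>z w. \<lbrakk>z \<in> cball 0 1; w \<in> cball 0 1; dist w z < \<delta>\<rbrakk> \<Longrightarrow> dist (R w) (R z) < 1/4"
    unfolding uniformly_continuous_on_def by (metis zero_less_divide_1_iff zero_less_numeral)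
  define s where "s = max 0 (1 - \<delta>/2)"
  have s: "0 \<le> s" "s < 1" "1 - s < \<delta>" using \<delta> by (auto simp: s_def)
  have var: "resolvent_variation_le b s (1/4)"
    unfolding resolvent_variation_le_def
  proof (intro allI impI)
    fix w :: complex
    assume w: "cmod w = 1"
    have "w - of_real s * w = of_real (1 - s) * w" by (simp add: algebra_simps)
    then have "dist w (of_real s * w) = 1 - s"
      using w s by (simp add: dist_norm norm_mult del: of_real_diff)
    moreover have "w \<in> cball 0 1" "of_real s * w \<in> cball 0 1"
      using w s by (auto simp: norm_mult)
    ultimately show "\<exists>c d. is_inverse (1 - w *\<^sub>C b) c \<and>
        is_inverse (1 - (of_real s * w) *\<^sub>C b) d \<and> norm (c - d) \<le> 1/4"
      using R unif[of "of_real s * w" w] s by (force simp: dist_norm)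
  qed
  \<comment> \<open>With variation \<open>1/4\<close> and \<open>S < 1/9\<close>, the inverse \<open>c\<close> of \<open>1 - B\<close> satisfies
    \<open>\<parallel>c - 1\<parallel> \<le> 1/4 + 1/8 = 3/8\<close>, and \<open>B c = c - 1\<close> then forces \<open>\<parallel>B\<parallel> \<le> 3/8 + 3/8 < 1\<close>.\<close>
  obtain n where n: "s ^ n < 1/9" using real_arch_pow_inv[of "1/9" s] s by auto
  define B S where "B = b ^ 2 ^ n" and "S = s ^ 2 ^ n"
  have "s ^ 2 ^ n \<le> s ^ n" using s less_exp[of n] by (intro power_decreasing) auto
  then have S: "0 \<le> S" "S < 1/9" using s n by (auto simp: S_def)
  have B: "norm B = 1" unfolding B_def using norm_power_two_power_self_adjoint[OF sa b1] by blast
  obtain c d where c: "is_inverse (1 - B) c" and d: "is_inverse (1 - S *\<^sub>R B) d"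
    and cd: "norm (c - d) \<le> 1/4"
    using resolvent_variation_power[OF var, of n, unfolded resolvent_variation_le_def,
        rule_format, of 1]
    by (auto simp: B_def S_def scaleC_of_real simp flip: of_real_power)
  have norm_le: "norm x \<le> 1 + norm (x - 1)" for x :: 'a
    using norm_triangle_sub[of x 1] norm_unit_le_1[where 'a='a] by linarith
  have "d - 1 = S *\<^sub>R (B * d)" using d by (simp add: is_inverse_def algebra_simps)
  then have "norm (d - 1) \<le> S * norm d"
    using norm_mult_ineq[of B d] B S by (simp add: mult_left_mono)
  also have "\<dots> \<le> (1/9) * norm d" using S by (intro mult_right_mono) auto
  also have "\<dots> \<le> (1/9) * (1 + norm (d - 1))" using norm_le[of d] by simp
  finally have "norm (d - 1) \<le> 1/8" by simp
  with cd have c1: "norm (c - 1) \<le> 3/8"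
    using norm_triangle_ineq[of "c - d" "d - 1"] by simp
  have "B = (c - 1) - B * (c - 1)" using c by (simp add: is_inverse_def algebra_simps)
  then have "norm B \<le> norm (c - 1) + norm (B * (c - 1))" by (metis norm_triangle_ineq4)
  also have "\<dots> \<le> norm (c - 1) + norm (c - 1)"
    using norm_mult_ineq[of B "c - 1"] B by simp
  finally show False using c1 B by simp
qed

text \<open>After normalising \<open>a\<close> to \<open>b = a / \<parallel>a\<parallel>\<close>, a point \<open>z\<close> of the closed unit disc at which \<open>1 - z b\<close> is
  not invertible yields the spectral value \<open>\<parallel>a\<parallel> / z\<close> of \<open>a\<close>, of modulus at least \<open>\<parallel>a\<parallel>\<close>.\<close>

lemma norm_le_spectral_bound:
  fixes a :: "'a::unital_cstar_algebra"
  assumes sa: "self_adjoint a" and sp: "\<And>z. z \<in> cstar_spectrum a \<Longrightarrow> cmod z \<le> r" and r: "0 \<le> r"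
  shows "norm a \<le> r"
proof (rule ccontr)
  assume "\<not> ?thesis"
  then have na: "r < norm a" by simp
  with r have pos: "norm a > 0" by linarith
  define b where "b = (1 / norm a) *\<^sub>R a"
  have "self_adjoint b" "norm b = 1"
    using sa pos by (simp_all add: b_def self_adjoint_def adj_scaleR)
  then obtain z where z: "cmod z \<le> 1" and ninv: "\<nexists>c. is_inverse (1 - z *\<^sub>C b) c"
    using not_all_invertible_on_disc by blast
  have z0: "z \<noteq> 0"
  proof
    assume "z = 0"
    then have "is_inverse (1 - z *\<^sub>C b) 1" by (simp add: is_inverse_def)
    with ninv show False by blast
  qed
  define l where "l = of_real (norm a) / z"
  have "cmod l \<ge> norm a" using z z0 pos by (simp add: l_def norm_divide field_simps)
  with na sp have "l \<notin> cstar_spectrum a" by force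
  then obtain c where c: "is_inverse (a - l *\<^sub>C 1) c" by (auto simp: in_spectrum_iff)
  have l0: "l \<noteq> 0" using z0 pos by (auto simp: l_def)
  have zb: "z *\<^sub>C b = inverse l *\<^sub>C a"
    by (simp add: b_def l_def scaleC_of_real[symmetric] scaleC_scaleC divide_inverse mult.commute)
  have "(- inverse l) *\<^sub>C (a - l *\<^sub>C 1) = 1 - z *\<^sub>C b"
    using l0 by (simp add: zb scaleC_minus_left scaleC_diff_right scaleC_scaleC)
  with is_inverse_scaleC[OF c, of "- inverse l"] l0 ninv show False by force
qed

section \<open>The positive cone\<close>

text \<open>Positivity becomes a norm condition, which, unlike the spectrum, behaves well under sums: the
  real spectrum of \<open>a\<close> is the reflection of that of \<open>t 1 - a\<close>, so it lies in \<open>[0, 2t]\<close> if the latter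
  has norm at most \<open>t\<close>.  Conversely the spectrum of a positive \<open>a\<close> of norm at most \<open>t\<close> lies in
  \<open>[0, t]\<close>, hence so does that of \<open>t 1 - a\<close>.\<close>

lemma cstar_posI_norm:
  fixes a :: "'a::unital_cstar_algebra"
  assumes sa: "self_adjoint a" and t: "norm (t *\<^sub>R 1 - a) \<le> t"
  shows "a \<in> cstar_pos"
proof -
  have "z \<in> complex_of_real ` {0..}" if z: "z \<in> cstar_spectrum a" for z
  proof -
    have re: "z = complex_of_real (Re z)" by (rule spectrum_self_adjoint_real[OF sa z])
    have "of_real t - z \<in> cstar_spectrum (of_real t *\<^sub>C 1 - a)"
      by (rule spectrum_reflect[of _ "of_real t" ]) (use z in simp)
    then have "cmod (of_real t - z) \<le> t"
      using spectrum_norm_bound t by (fastforce simp: scaleC_of_real)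
    then have "\<bar>t - Re z\<bar> \<le> t" by (metis re norm_of_real of_real_diff)
    then have "0 \<le> Re z" by simp
    then show ?thesis using re by force
  qed
  with sa show ?thesis by (auto simp: cstar_pos_def)
qed

lemma cstar_pos_norm_le:
  fixes a :: "'a::unital_cstar_algebra"
  assumes a: "a \<in> cstar_pos" and le: "norm a \<le> t"
  shows "norm (t *\<^sub>R 1 - a) \<le> t"
proof (rule norm_le_spectral_bound)
  show "self_adjoint (t *\<^sub>R 1 - a)"
    using a by (simp add: cstar_pos_def self_adjoint_def adj_diff adj_scaleR)
  show "0 \<le> t" using le norm_ge_zero order_trans by blast
  fix z
  assume "z \<in> cstar_spectrum (t *\<^sub>R 1 - a)"
  then have z: "of_real t - z \<in> cstar_spectrum a"
    using spectrum_reflect[of z "of_real t" a] by (simp add: scaleC_of_real)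
  then obtain x where x: "0 \<le> x" "of_real t - z = complex_of_real x"
    using a by (auto simp: cstar_pos_def)
  have "x \<le> t" using spectrum_norm_bound[OF z] x le by simp
  moreover have "z = complex_of_real (t - x)" using x(2) by (simp add: algebra_simps)
  ultimately show "cmod z \<le> t" using x(1) by (metis abs_of_nonneg diff_ge_0_iff_ge diff_le_eq
        le_add_same_cancel1 norm_of_real)
qed

lemma cstar_pos_add:
  fixes a b :: "'a::unital_cstar_algebra"
  assumes a: "a \<in> cstar_pos" and b: "b \<in> cstar_pos"
  shows "a + b \<in> cstar_pos"
proof (rule cstar_posI_norm)
  show "self_adjoint (a + b)" using a b by (simp add: cstar_pos_def self_adjoint_def adj_add)
  have split: "(norm a + norm b) *\<^sub>R 1 - (a + b) = (norm a *\<^sub>R 1 - a) + (norm b *\<^sub>R 1 - b)"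
    by (simp add: scaleR_add_left)
  show "norm ((norm a + norm b) *\<^sub>R 1 - (a + b)) \<le> norm a + norm b"
    unfolding split
    using norm_triangle_ineq[of "norm a *\<^sub>R 1 - a" "norm b *\<^sub>R 1 - b"]
      cstar_pos_norm_le[OF a order_refl] cstar_pos_norm_le[OF b order_refl] by linarith
qed

lemma cstar_pos_scaleR:
  fixes a :: "'a::unital_cstar_algebra"
  assumes a: "a \<in> cstar_pos" and r: "0 \<le> r"
  shows "r *\<^sub>R a \<in> cstar_pos"
proof (rule cstar_posI_norm)
  show "self_adjoint (r *\<^sub>R a)" using a by (simp add: cstar_pos_def self_adjoint_def adj_scaleR)
  have "(r * norm a) *\<^sub>R 1 - r *\<^sub>R a = r *\<^sub>R (norm a *\<^sub>R 1 - a)" by (simp add: algebra_simps)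
  then show "norm ((r * norm a) *\<^sub>R 1 - r *\<^sub>R a) \<le> r * norm a"
    using cstar_pos_norm_le[OF a order_refl] r by (simp add: mult_left_mono)
qed

lemma cstar_le_iff_pos:
  assumes "self_adjoint a" "self_adjoint b"
  shows "a \<preceq> b \<longleftrightarrow> b - a \<in> cstar_pos"
  using assms by (simp add: cstar_le_def)

lemma zero_cstar_le_iff: "0 \<preceq> (a::'a::unital_cstar_algebra) \<longleftrightarrow> a \<in> cstar_pos"
  by (auto simp: cstar_le_def cstar_pos_def self_adjoint_def)

text \<open>From \<open>b \<preceq> \<parallel>b\<parallel> 1\<close> and the additivity of the cone, the spectrum of \<open>a\<close> lies in
  \<open>[0, \<parallel>b\<parallel>]\<close>.\<close>

lemma norm_mono_cstar_pos:
  fixes a b :: "'a::unital_cstar_algebra"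
  assumes a: "a \<in> cstar_pos" and ba: "b - a \<in> cstar_pos"
  shows "norm a \<le> norm b"
proof (rule norm_le_spectral_bound)
  show sa: "self_adjoint a" using a by (simp add: cstar_pos_def)
  have sb: "self_adjoint b" using ba sa by (simp add: cstar_pos_def self_adjoint_def adj_diff)
  have "norm b *\<^sub>R 1 - b \<in> cstar_pos"
    by (rule cstar_posI_norm[of _ "norm b"])
      (use sb in \<open>simp_all add: self_adjoint_def adj_diff adj_scaleR\<close>)
  from cstar_pos_add[OF this ba] have pos: "norm b *\<^sub>R 1 - a \<in> cstar_pos" by simp
  fix z
  assume z: "z \<in> cstar_spectrum a"
  then obtain x where x: "0 \<le> x" "z = complex_of_real x" using a by (auto simp: cstar_pos_def)
  have "of_real (norm b) - z \<in> cstar_spectrum (of_real (norm b) *\<^sub>C 1 - a)"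
    by (rule spectrum_reflect[of _ "of_real (norm b)"]) (use z in simp)
  then have "of_real (norm b) - z \<in> cstar_spectrum (norm b *\<^sub>R 1 - a)"
    by (simp only: scaleC_of_real)
  then obtain y where "0 \<le> y" "of_real (norm b) - z = complex_of_real y"
    using pos by (auto simp: cstar_pos_def)
  then have "0 \<le> norm b - x" using x(2) by (metis of_real_diff of_real_eq_iff)
  then show "cmod z \<le> norm b" using x by simp
qed simp

section \<open>Kannan contractions\<close>

context cstar_partial_metric_space
begin

lemma p_pos: "\<lbrakk>x \<in> X; y \<in> X\<rbrakk> \<Longrightarrow> p x y \<in> cstar_pos"
  using nonneg by (simp add: zero_cstar_le_iff)

lemma norm_self_distance_le:
  assumes "x \<in> X" "y \<in> X"
  shows "norm (p x x) \<le> norm (p x y)"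
  using small_self_distance[OF assms] p_pos[OF assms(1) assms(1)]
  by (intro norm_mono_cstar_pos) (simp_all add: cstar_le_def)

lemma norm_centred_le:
  assumes "x \<in> X" "y \<in> X"
  shows "norm (centred x y) \<le> 2 * norm (p x y)"
  using norm_self_distance_le[OF assms] norm_self_distance_le[OF assms(2,1)] sym[OF assms]
    norm_triangle_ineq4[of "p x y - (1/2) *\<^sub>R p x x" "(1/2) *\<^sub>R p y y"]
    norm_triangle_ineq4[of "p x y" "(1/2) *\<^sub>R p x x"]
  unfolding centred_def by simp

text \<open>Since \<open>q q\<^sup>*\<close> has norm \<open>\<parallel>q\<parallel>\<^sup>2\<close>, it lies below \<open>\<epsilon>\<^sup>2 1\<close> as soon as \<open>\<parallel>q\<parallel> \<le> \<epsilon>\<close>.\<close>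

lemma partial_CauchyI_norm:
  assumes "\<And>\<epsilon>. \<epsilon> > 0 \<Longrightarrow> \<exists>N. \<forall>n>N. \<forall>m>N. norm (centred (s n) (s m)) \<le> \<epsilon>"
  shows "partial_Cauchy s"
proof -
  have "q * adj q \<preceq> \<epsilon>\<^sup>2 *\<^sub>R 1" if "norm q \<le> \<epsilon>" for q :: 'a and \<epsilon> :: real
  proof -
    have sa: "self_adjoint (q * adj q)" "self_adjoint (\<epsilon>\<^sup>2 *\<^sub>R (1::'a))"
      by (simp_all add: self_adjoint_def adj_mult adj_adj adj_scaleR)
    have "norm (q * adj q) = (norm q)\<^sup>2"
      using cstar_identity[of "adj q"] by (simp add: adj_adj norm_adj)
    also have "\<dots> \<le> \<epsilon>\<^sup>2" using that by (simp add: power_mono)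
    finally have "\<epsilon>\<^sup>2 *\<^sub>R 1 - q * adj q \<in> cstar_pos"
      using sa by (intro cstar_posI_norm[of _ "\<epsilon>\<^sup>2"]) (auto simp: self_adjoint_def adj_diff)
    with sa show ?thesis by (simp add: cstar_le_iff_pos)
  qed
  with assms show ?thesis unfolding partial_Cauchy_def by meson
qed

text \<open>Completeness compares the limit of \<open>p (s n) u\<close> in two ways: it is \<open>p u u\<close> by convergence, and
  \<open>p u u / 2\<close> by the vanishing of the centred distances.\<close>

lemma limit_of_small_sequence:
  assumes u: "pm_converges s u" and cen: "(\<lambda>n. centred (s n) u) \<longlonglongrightarrow> 0"
    and self: "(\<lambda>n. p (s n) (s n)) \<longlonglongrightarrow> 0"
  shows "p u u = 0" and "(\<lambda>n. p (s n) u) \<longlonglongrightarrow> 0"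
proof -
  have l1: "(\<lambda>n. p (s n) u) \<longlonglongrightarrow> p u u"
    using u unfolding pm_converges_def by (simp add: LIM_zero_iff)
  have "(\<lambda>n. centred (s n) u + (1/2) *\<^sub>R p (s n) (s n) + (1/2) *\<^sub>R p u u)
      \<longlonglongrightarrow> 0 + (1/2) *\<^sub>R 0 + (1/2) *\<^sub>R p u u"
    by (intro tendsto_intros cen self)
  then have "(\<lambda>n. p (s n) u) \<longlonglongrightarrow> (1/2) *\<^sub>R p u u" by (simp add: centred_def)
  with l1 have "p u u = (1/2) *\<^sub>R p u u" by (rule LIMSEQ_unique)
  then have "(1 - 1/2) *\<^sub>R p u u = 0" unfolding scaleR_diff_left by simp
  then show "p u u = 0" by simp
  with l1 show "(\<lambda>n. p (s n) u) \<longlonglongrightarrow> 0" by simp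
qed

lemma eq_if_distance_zero:
  assumes "x \<in> X" "y \<in> X" "p x y = 0"
  shows "x = y"
  using norm_self_distance_le[OF assms(1,2)] norm_self_distance_le[OF assms(2,1)] sym[OF assms(1,2)]
    eq_iff[OF assms(1,2)] assms(3)
  by simp

end

text \<open>If \<open>a \<preceq> b + k a\<close>, then \<open>(1 - k) a \<preceq> b\<close>, and both sides are comparable in norm since the left
  one is positive.\<close>

lemma norm_absorb:
  fixes a b :: "'a::unital_cstar_algebra"
  assumes a: "a \<in> cstar_pos" and le: "(b + k *\<^sub>R a) - a \<in> cstar_pos" and k: "k < 1"
  shows "norm a \<le> norm b / (1 - k)"
proof -
  have "(1 - k) *\<^sub>R a \<in> cstar_pos" using a k by (intro cstar_pos_scaleR) auto
  moreover have "b - (1 - k) *\<^sub>R a \<in> cstar_pos" using le by (simp add: algebra_simps)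
  ultimately have "norm ((1 - k) *\<^sub>R a) \<le> norm b" by (rule norm_mono_cstar_pos)
  then have "(1 - k) * norm a \<le> norm b" using k by simp
  then show ?thesis using k by (simp add: field_simps)
qed

theorem corollary4p4:
  fixes X :: "'b set"
    and p :: "'b \<Rightarrow> 'b \<Rightarrow> 'a::unital_cstar_algebra"
    and T :: "'b \<Rightarrow> 'b"
    and k :: real
  assumes "cstar_partial_metric_space X p"
    and "cstar_partial_metric_space.pm_complete X p"
    and "T \<in> X \<rightarrow> X"
    and "0 < k" and "k < 1/2"
    and "\<And>x y. \<lbrakk>x \<in> X; y \<in> X\<rbrakk> \<Longrightarrow> p (T x) (T y) \<preceq> k *\<^sub>R (p x (T x) + p y (T y))"
  shows "\<exists>u\<in>X. T u = u \<and> (\<forall>v\<in>X. T v = v \<longrightarrow> v = u) \<and> p u u = 0"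
proof -
  interpret cstar_partial_metric_space X p by fact
  note k0 = assms(4) and k1 = assms(5)
  have T: "T x \<in> X" if "x \<in> X" for x using assms(3) that by auto
  have kannan: "k *\<^sub>R (p x (T x) + p y (T y)) - p (T x) (T y) \<in> cstar_pos" if "x \<in> X" "y \<in> X" for x y
    using assms(6)[OF that] by (simp add: cstar_le_def)
  have kannan_norm: "norm (p (T x) (T y)) \<le> k * (norm (p x (T x)) + norm (p y (T y)))"
    if "x \<in> X" "y \<in> X" for x y
  proof -
    have "norm (p (T x) (T y)) \<le> norm (k *\<^sub>R (p x (T x) + p y (T y)))"
      using kannan[OF that] that T p_pos by (intro norm_mono_cstar_pos) auto
    also have "\<dots> \<le> k * (norm (p x (T x)) + norm (p y (T y)))"
      using k0 norm_triangle_ineq by (simp add: mult_left_mono)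
    finally show ?thesis .
  qed
  define r where "r = k / (1 - k)"
  have r: "0 \<le> r" "r < 1" using k0 k1 by (auto simp: r_def field_simps)
  obtain x0 where x0: "x0 \<in> X" using nonempty by blast
  define s where "s n = (T ^^ n) x0" for n
  have sX: "s n \<in> X" for n by (induction n) (auto simp: s_def x0 T)
  have sT: "T (s n) = s (Suc n)" for n by (simp add: s_def)
  define d where "d n = norm (p (s n) (s (Suc n)))" for n
  have d_step: "d (Suc n) \<le> r * d n" for n
    using kannan[OF sX[of n] sX[of "Suc n"]] norm_absorb[OF p_pos[OF sX[of "Suc n"] sX[of "Suc (Suc n)"]],
        of "k *\<^sub>R p (s n) (s (Suc n))" k] k0 k1
    by (simp add: sT d_def r_def scaleR_add_right)
  have d_bound: "d n \<le> r ^ n * d 0" for n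
  proof (induction n)
    case (Suc n)
    have "d (Suc n) \<le> r * (r ^ n * d 0)"
      using d_step[of n] mult_left_mono[OF Suc r(1)] by linarith
    then show ?case by simp
  qed simp
  have "(\<lambda>n. r ^ n * d 0) \<longlonglongrightarrow> 0"
    using LIMSEQ_power_zero[of r] r by (intro tendsto_mult_left_zero) simp
  then have d0: "d \<longlonglongrightarrow> 0"
    by (rule Lim_null_comparison[rotated]) (use d_bound in \<open>auto simp: d_def\<close>)
  have self: "(\<lambda>n. p (s n) (s n)) \<longlonglongrightarrow> 0"
  proof (rule Lim_null_comparison[OF _ d0])
    show "\<forall>\<^sub>F n in sequentially. norm (p (s n) (s n)) \<le> d n"
      using norm_self_distance_le sX by (simp add: d_def)
  qed
  have "partial_Cauchy s"
  proof (rule partial_CauchyI_norm)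
    fix \<epsilon> :: real
    assume e: "\<epsilon> > 0"
    then obtain N where N: "\<And>n. n \<ge> N \<Longrightarrow> d n < \<epsilon> / 2"
      using order_tendstoD(2)[OF d0, of "\<epsilon>/2"] by (auto simp: eventually_sequentially)
    have "norm (centred (s n) (s m)) \<le> \<epsilon>" if nm: "n > N" "m > N" for n m
    proof -
      obtain i j where ij: "n = Suc i" "m = Suc j" "i \<ge> N" "j \<ge> N"
        using nm by (cases n; cases m) auto
      have "norm (p (s n) (s m)) \<le> k * (d i + d j)"
        using kannan_norm[OF sX[of i] sX[of j]] by (simp add: sT ij d_def)
      also have "\<dots> \<le> (1/2) * (d i + d j)"
        using k1 by (intro mult_right_mono) (auto simp: d_def)
      also have "\<dots> \<le> \<epsilon> / 2" using N[OF ij(3)] N[OF ij(4)] by simp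
      finally show ?thesis using norm_centred_le[OF sX[of n] sX[of m]] by simp
    qed
    then show "\<exists>N. \<forall>n>N. \<forall>m>N. norm (centred (s n) (s m)) \<le> \<epsilon>" by blast
  qed
  then obtain u where u: "u \<in> X" and "pm_converges s u" "(\<lambda>n. centred (s n) u) \<longlonglongrightarrow> 0"
    using assms(2) sX unfolding pm_complete_def by blast
  from limit_of_small_sequence[OF this(2,3) self]
  have uu: "p u u = 0" and lim: "(\<lambda>n. p (s n) u) \<longlonglongrightarrow> 0" .
  have key: "norm (p u (T u)) \<le> (norm (p (s (Suc n)) u) + k * d n) / (1 - k)" for n
  proof -
    let ?b = "p (s (Suc n)) u + k *\<^sub>R p (s n) (s (Suc n))"
    let ?y = "s (Suc n)"
    have "p u ?y + p ?y (T u) - p ?y ?y - p u (T u) \<in> cstar_pos"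
      using triangle[OF u T[OF u] sX[of "Suc n"]] by (simp add: cstar_le_def)
    \<comment> \<open>Discard the self-distance of \<open>?y\<close> and bound \<open>p ?y (T u)\<close> by the contraction condition.\<close>
    from cstar_pos_add[OF cstar_pos_add[OF this p_pos[OF sX[of "Suc n"] sX[of "Suc n"]]] kannan[OF sX[of n] u]]
    have "(?b + k *\<^sub>R p u (T u)) - p u (T u) \<in> cstar_pos"
      using sym[OF u sX[of "Suc n"]] by (simp add: sT algebra_simps)
    from norm_absorb[OF p_pos[OF u T[OF u]] this] k1
    have "norm (p u (T u)) \<le> norm ?b / (1 - k)" by simp
    also have "\<dots> \<le> (norm (p (s (Suc n)) u) + k * d n) / (1 - k)"
      using k0 k1 norm_triangle_ineq[of "p (s (Suc n)) u" "k *\<^sub>R p (s n) (s (Suc n))"]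
      by (intro divide_right_mono) (auto simp: d_def)
    finally show ?thesis .
  qed
  have "(\<lambda>n. (norm (p (s (Suc n)) u) + k * d n) / (1 - k)) \<longlonglongrightarrow> (norm (0::'a) + k * 0) / (1 - k)"
    using k1 by (intro tendsto_intros LIMSEQ_Suc[OF lim] d0) auto
  then have "norm (p u (T u)) \<le> (norm (0::'a) + k * 0) / (1 - k)"
    by (rule LIMSEQ_le_const) (use key in blast)
  then have "p u (T u) = 0" by simp
  from eq_if_distance_zero[OF u T[OF u] this] have Tu: "T u = u" by simp
  have "v = u" if v: "v \<in> X" "T v = v" for v
  proof -
    have "norm (p v v) \<le> 2 * k * norm (p v v)"
      using kannan_norm[OF v(1) v(1)] v(2) by simp
    then have "(1 - 2 * k) * norm (p v v) \<le> 0" by (simp add: algebra_simps)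
    then have "p v v = 0" using k1 by (simp add: mult_le_0_iff)
    then have "p v u = 0" using kannan_norm[OF v(1) u] v(2) Tu uu by simp
    then show ?thesis using eq_if_distance_zero v(1) u by blast
  qed
  with u Tu uu show ?thesis by blast
qed

end
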